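(* Let $\Phi$ be a block tridiagonal quantum Markov chain on $\mathbb{Z}_{\ge 0}$ with internal space $\mathbb{C}^N$ and matrix representation $$\Phi=\begin{bmatrix} B_0 & C_1 & & \\ A_0 & B_1 & C_2 & \\ & A_1 & B_2 & C_3 \\ & & \ddots & \ddots & \ddots\end{bmatrix},\qquad A_n,B_n,C_{n+1}\in M_{N^2}(\mathbb{C}),\ n\ge 0,$$ with all $A_n$, $C_{n+1}$, $n\ge0$, nonsingular. Suppose there is a sequence of nonsingular matrices $(R_n)_{n\ge 0}$ in $M_{N^2}(\mathbb{C})$ such that $R_nB_nR_n^{-1}$ is Hermitian for all $n\ge 0$ and $R_n^*R_n=(A_0^*\cdots A_{n-1}^* )^{-1}(R_0^*R_0)\,C_1\cdots C_n$ for all $n\ge 1$. Let $(Q_n)_{n\ge 0}$ be the matrix-valued polynomials associated with $\Phi$, and let $s\ne 0$ satisfy $\|s\Phi\|<1$. Then for all $0\le i<j$ the first passage time operator from $i$ to $j$ is $$F_{ji}(s)=Q_j(s^{-1})^{-1}\,Q_i(s^{-1}).$$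
   Context: A quantum Markov chain (QMC) on a vertex set $V$ with internal space $\mathbb{C}^N$ is a block matrix $\Phi=(\Phi_{ij})_{i,j\in V}$ of completely positive maps $\Phi_{ij}$ on $M_N(\mathbb{C})$ such that each column sum $\sum_{i\in V}\Phi_{ij}$ is trace-preserving. It acts on columns $(\rho_j)_{j\in V}$ with $\sum_j\|\rho_j\|_1<\infty$ ($\|\cdot\|_1$ the trace norm) by $\Phi(\rho)_i=\sum_j\Phi_{ij}(\rho_j)$, and $\|\Phi\|$ is the operator norm on this Banach space. The matrix representation replaces each $\Phi_{ij}$ by the $N^2\times N^2$ matrix $M$ with $\mathrm{vec}(\Phi_{ij}(X))=M\,\mathrm{vec}(X)$, where $\mathrm{vec}$ stacks the rows of a matrix; $A_n,B_n,C_n$ are the blocks in positions $(n+1,n)$, $(n,n)$, $(n-1,n)$. The associated matrix-valued polynomials are given by $Q_0(x)=I$, $Q_{-1}(x)=0$, $xQ_n(x)=Q_{n+1}(x)A_n+Q_n(x)B_n+Q_{n-1}(x)C_n$, $n\ge 0$. Let $\mathbb{P}_k$ be the projection onto the component at vertex $k$ and $\mathbb{Q}_k=I-\mathbb{P}_k$. The first passage time operator $F_{ji}(s)$ is the $N^2\times N^2$ block of $s\,\mathbb{P}_j\Phi(I-s\,\mathbb{Q}_j\Phi)^{-1}\mathbb{P}_i$ in position $(j,i)$; equivalently $F_{ji}(s)=\Phi_{jj}(s)^{-1}(\Phi_{ji}(s)-\delta_{ji}I)$, where $\Phi_{ji}(s)=\sum_{n\ge 0}s^n(\Phi^n)_{ji}$.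 *)

theory Defs
  imports "HOL-Analysis.Analysis"
begin

type_synonym 'n cmat = "complex^'n^'n"

definition cadj :: "'n::finite cmat \<Rightarrow> 'n cmat"
  where "cadj X = transpose (map_matrix cnj X)"

definition hermitian :: "'n::finite cmat \<Rightarrow> bool"
  where "hermitian X \<longleftrightarrow> cadj X = X"

definition mscale :: "complex \<Rightarrow> 'n::finite cmat \<Rightarrow> 'n cmat"
  where "mscale c X = map_matrix ((*) c) X"

text \<open>The library's inner product on \<open>complex^'n\<close> is the real one, hence a separate
  sesquilinear form.\<close>

definition cdot :: "complex^'n::finite \<Rightarrow> complex^'n \<Rightarrow> complex"
  where "cdot u w = (\<Sum>i\<in>UNIV. cnj (u $ i) * w $ i)"

definition psd :: "'n::finite cmat \<Rightarrow> bool"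
  where "psd X \<longleftrightarrow> (\<forall>v. cdot v (X *v v) \<in> \<real>\<^sub>\<ge>\<^sub>0)"

text \<open>Positive semidefiniteness of the \<open>k \<times> k\<close> block matrix with blocks \<open>X a b\<close>,
  \<open>a, b < k\<close>, as an element of \<open>M_k(M_N)\<close>.\<close>

definition block_psd :: "nat \<Rightarrow> (nat \<Rightarrow> nat \<Rightarrow> 'n::finite cmat) \<Rightarrow> bool"
  where "block_psd k X \<longleftrightarrow>
    (\<forall>v. (\<Sum>a<k. \<Sum>b<k. cdot (v a) (X a b *v v b)) \<in> \<real>\<^sub>\<ge>\<^sub>0)"

definition completely_positive :: "('n::finite cmat \<Rightarrow> 'n cmat) \<Rightarrow> bool"
  where "completely_positive L \<longleftrightarrow>
    Vector_Spaces.linear mscale mscale L \<and>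
    (\<forall>k X. block_psd k X \<longrightarrow> block_psd k (\<lambda>a b. L (X a b)))"

definition mat_abs :: "'n::finite cmat \<Rightarrow> 'n cmat"
  where "mat_abs X = (THE P. psd P \<and> P ** P = cadj X ** X)"

definition trace_norm :: "'n::finite cmat \<Rightarrow> real"
  where "trace_norm X = Re (trace (mat_abs X))"

text \<open>Columns over the vertex set, which is the type \<open>'v\<close>.\<close>

type_synonym ('v, 'n) col = "'v \<Rightarrow> 'n cmat"

definition col_norm :: "('v, 'n::finite) col \<Rightarrow> ennreal"
  where "col_norm \<rho> = (\<Sum>\<^sub>\<infinity>v\<in>UNIV. ennreal (trace_norm (\<rho> v)))"

definition col_space :: "('v, 'n::finite) col set"
  where "col_space = {\<rho>. col_norm \<rho> < \<infinity>}"

definition col_scale :: "complex \<Rightarrow> ('v, 'n::finite) col \<Rightarrow> ('v, 'n) col"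
  where "col_scale c \<rho> = (\<lambda>v. mscale c (\<rho> v))"

definition col_single :: "'v \<Rightarrow> 'n::finite cmat \<Rightarrow> ('v, 'n) col"
  where "col_single k X = (\<lambda>v. if v = k then X else 0)"

definition op_norm :: "(('v, 'n::finite) col \<Rightarrow> ('v, 'n) col) \<Rightarrow> ennreal"
  where "op_norm T = (SUP \<rho>\<in>{\<rho>. col_norm \<rho> \<le> 1}. col_norm (T \<rho>))"

definition qmc :: "('v \<Rightarrow> 'v \<Rightarrow> 'n::finite cmat \<Rightarrow> 'n cmat) \<Rightarrow> bool"
  where "qmc \<Phi> \<longleftrightarrow>
    (\<forall>i j. completely_positive (\<Phi> i j)) \<and>
    (\<forall>j X. (\<lambda>i. \<Phi> i j X) summable_on UNIV \<and>
           trace (\<Sum>\<^sub>\<infinity>i\<in>UNIV. \<Phi> i j X) = trace X)"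

definition qmc_op ::
  "('v \<Rightarrow> 'v \<Rightarrow> 'n::finite cmat \<Rightarrow> 'n cmat) \<Rightarrow> ('v, 'n) col \<Rightarrow> ('v, 'n) col"
  where "qmc_op \<Phi> \<rho> = (\<lambda>i. \<Sum>\<^sub>\<infinity>j\<in>UNIV. \<Phi> i j (\<rho> j))"

definition block_tridiagonal :: "(nat \<Rightarrow> nat \<Rightarrow> 'n::finite cmat \<Rightarrow> 'n cmat) \<Rightarrow> bool"
  where "block_tridiagonal \<Phi> \<longleftrightarrow> (\<forall>i j. i > Suc j \<or> j > Suc i \<longrightarrow> \<Phi> i j = (\<lambda>X. 0))"

text \<open>\<open>M_{N^2}\<close> is the type of matrices indexed by \<open>'n \<times> 'n\<close>; the position \<open>(i, j)\<close> of
  \<open>vec_rows X\<close> holds the entry of \<open>X\<close> in row \<open>i\<close>, column \<open>j\<close>, so the lexicographic order of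
  the index pairs stacks the rows.\<close>

definition vec_rows :: "'n::finite cmat \<Rightarrow> complex^('n \<times> 'n)"
  where "vec_rows X = (\<chi> p. X $ fst p $ snd p)"

definition mat_rep :: "('n::finite cmat \<Rightarrow> 'n cmat) \<Rightarrow> ('n \<times> 'n) cmat"
  where "mat_rep L = (THE M. \<forall>X. vec_rows (L X) = M *v vec_rows X)"

definition proj_at :: "'v \<Rightarrow> ('v, 'n::finite) col \<Rightarrow> ('v, 'n) col"
  where "proj_at k \<rho> = (\<lambda>v. if v = k then \<rho> v else 0)"

definition coproj_at :: "'v \<Rightarrow> ('v, 'n::finite) col \<Rightarrow> ('v, 'n) col"
  where "coproj_at k \<rho> = (\<lambda>v. \<rho> v - proj_at k \<rho> v)"

definition op_block ::
  "(('v, 'n::finite) col \<Rightarrow> ('v, 'n) col) \<Rightarrow> 'v \<Rightarrow> 'v \<Rightarrow> 'n cmat \<Rightarrow> 'n cmat"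
  where "op_block T j i X = T (col_single i X) j"

text \<open>The resolvent \<open>(I - s Q_j \<Phi>)^{-1}\<close>, an inverse on the Banach space of columns.\<close>

definition passage_resolvent ::
  "('v \<Rightarrow> 'v \<Rightarrow> 'n::finite cmat \<Rightarrow> 'n cmat) \<Rightarrow> complex \<Rightarrow> 'v \<Rightarrow> ('v, 'n) col \<Rightarrow> ('v, 'n) col"
  where "passage_resolvent \<Phi> s j =
    inv_into col_space (\<lambda>\<rho> v. \<rho> v - col_scale s (coproj_at j (qmc_op \<Phi> \<rho>)) v)"

definition first_passage ::
  "('v \<Rightarrow> 'v \<Rightarrow> 'n::finite cmat \<Rightarrow> 'n cmat) \<Rightarrow> complex \<Rightarrow> 'v \<Rightarrow> 'v \<Rightarrow> ('n \<times> 'n) cmat"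
  where "first_passage \<Phi> s j i =
    mat_rep (op_block
      (\<lambda>\<rho>. col_scale s (proj_at j (qmc_op \<Phi> (passage_resolvent \<Phi> s j (proj_at i \<rho>))))) j i)"

text \<open>The \<open>n\<close>-th polynomial is represented by its evaluation \<open>Q n :: complex \<Rightarrow> _\<close>. For
  nonsingular \<open>A n\<close> the recurrence determines all \<open>Q n\<close>, and they are polynomial functions.
  The case \<open>n = 0\<close> is the one with \<open>Q\<^sub>-\<^sub>1 = 0\<close>, so that \<open>C 0\<close> does not occur.\<close>

definition assoc_polys ::
  "(nat \<Rightarrow> 'm::finite cmat) \<Rightarrow> (nat \<Rightarrow> 'm cmat) \<Rightarrow> (nat \<Rightarrow> 'm cmat) \<Rightarrow>
   (nat \<Rightarrow> complex \<Rightarrow> 'm cmat) \<Rightarrow> bool"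
  where "assoc_polys A B C Q \<longleftrightarrow>
    (\<forall>x. Q 0 x = mat 1 \<and>
         mscale x (Q 0 x) = Q 1 x ** A 0 + Q 0 x ** B 0 \<and>
         (\<forall>n. mscale x (Q (Suc n) x) =
                Q (Suc (Suc n)) x ** A (Suc n) + Q (Suc n) x ** B (Suc n) + Q n x ** C (Suc n)))"

primrec mat_prod :: "(nat \<Rightarrow> 'm::finite cmat) \<Rightarrow> nat \<Rightarrow> 'm cmat"
  where
    "mat_prod M 0 = mat 1"
  | "mat_prod M (Suc n) = mat_prod M n ** M n"

end

theory Submission
  imports Defs
begin

text \<open>The recurrence says that the row \<open>(Q\<^sub>0(x), Q\<^sub>1(x), \<dots>)\<close> is a left eigenvector of \<open>\<Phi>\<close>
  with eigenvalue \<open>x = 1/s\<close>. Let \<open>\<psi>\<close> be the column that the resolvent assigns to \<open>X\<close> at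
  vertex \<open>i < j\<close>. It vanishes at \<open>j\<close>, and beyond \<open>j\<close> it is a fixed point of a compression of the
  contraction \<open>s \<Phi>\<close>, so it vanishes there too. Pairing the rows \<open>k < j\<close> of the equation for \<open>\<psi>\<close>
  with the \<open>Q\<^sub>k\<close>, everything telescopes to \<open>Q\<^sub>j s(\<Phi>\<psi>)\<^sub>j = Q\<^sub>i X\<close>, that is,
  \<open>Q\<^sub>j F\<^sub>j\<^sub>i = Q\<^sub>i\<close>. The case \<open>i = 0\<close>, where \<open>Q\<^sub>0 = I\<close>, shows that \<open>Q\<^sub>j\<close> is
  invertible. The resolvent equation itself is a boundary value problem for a three-term
  recurrence on \<open>{0, \<dots>, j}\<close>; it is solvable because the contraction makes it uniquely solvable.\<close>

section \<open>Square roots of positive semidefinite matrices\<close>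

lemma matrix_diff_ldistrib: "X ** (Y - Z) = X ** Y - X ** (Z :: 'n::finite cmat)"
  by (simp add: vec_eq_iff matrix_matrix_mult_def sum_subtractf algebra_simps)

lemma matrix_diff_rdistrib: "(Y - Z) ** X = Y ** X - (Z :: 'n::finite cmat) ** X"
  by (simp add: vec_eq_iff matrix_matrix_mult_def sum_subtractf algebra_simps)

lemma matrix_add_rdistrib: "(Y + Z) ** X = Y ** X + (Z :: 'n::finite cmat) ** X"
  by (simp add: vec_eq_iff matrix_matrix_mult_def sum.distrib algebra_simps)

lemma matrix_mul_vector_assoc: "(A ** B) *v v = A *v (B *v v)"
  by (simp add: matrix_vector_mul_assoc)

lemma mscale_nth [simp]: "mscale c X $ i $ j = c * X $ i $ j"
  by (simp add: mscale_def)

lemma mscale_zero: "mscale 0 X = 0"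
  by (simp add: vec_eq_iff)

lemma cadj_nth [simp]: "cadj X $ i $ j = cnj (X $ j $ i)"
  by (simp add: cadj_def transpose_def)

lemma cadj_mult: "cadj (X ** Y) = cadj Y ** cadj X"
  by (simp add: vec_eq_iff matrix_matrix_mult_def mult.commute)

lemma mscale_vector_mult: "mscale c X *v v = c *s (X *v v)"
  by (simp add: vec_eq_iff matrix_vector_mult_def sum_distrib_left mult.assoc)

lemma cdot_add_right: "cdot u (v + w) = cdot u v + cdot u w"
  by (simp add: cdot_def algebra_simps sum.distrib)

lemma cdot_add_left: "cdot (u + v) w = cdot u w + cdot v w"
  by (simp add: cdot_def algebra_simps sum.distrib)

lemma cdot_scale_right: "cdot u (c *s v) = c * cdot u v"
  by (simp add: cdot_def sum_distrib_left mult_ac)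

lemma cdot_scale_left: "cdot (c *s u) v = cnj c * cdot u v"
  by (simp add: cdot_def sum_distrib_left mult_ac)

lemma cdot_adjoint: "cdot u (X *v v) = cdot (cadj X *v u) v"
proof -
  have "cdot u (X *v v) = (\<Sum>i\<in>UNIV. \<Sum>j\<in>UNIV. cnj (u $ i) * X $ i $ j * v $ j)"
    by (simp add: cdot_def matrix_vector_mult_def sum_distrib_left mult.assoc)
  also have "\<dots> = (\<Sum>j\<in>UNIV. \<Sum>i\<in>UNIV. cnj (u $ i) * X $ i $ j * v $ j)"
    by (rule sum.swap)
  also have "\<dots> = cdot (cadj X *v u) v"
    by (simp add: cdot_def matrix_vector_mult_def sum_distrib_left sum_distrib_right mult_ac)
  finally show ?thesis .
qed

lemma cdot_self: "cdot v v = of_real ((norm v)\<^sup>2)"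
proof -
  have "cdot v v = (\<Sum>i\<in>UNIV. of_real ((norm (v $ i))\<^sup>2))"
    unfolding cdot_def by (intro sum.cong refl) (simp only: complex_norm_square mult.commute)
  also have "\<dots> = of_real ((norm v)\<^sup>2)"
    by (simp add: norm_vec_def L2_set_def sum_nonneg)
  finally show ?thesis .
qed

lemma matrix_vector_axis: "((X :: 'n::finite cmat) *v axis j 1) $ i = X $ i $ j"
proof -
  have "(X *v axis j 1) $ i = (\<Sum>k\<in>UNIV. if k = j then X $ i $ k else 0)"
    unfolding matrix_vector_mult_def vec_lambda_beta by (intro sum.cong) (simp_all add: axis_def)
  then show ?thesis
    by simp
qed

lemma cdot_axis: "cdot (axis i 1) v = v $ i"
proof -
  have "cdot (axis i 1) v = (\<Sum>k\<in>UNIV. if k = i then v $ k else 0)"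
    unfolding cdot_def by (intro sum.cong) (simp_all add: axis_def)
  then show ?thesis
    by simp
qed

text \<open>Polarization: the form is real at \<open>v + w\<close> and at
  \<open>v + \<i> *s w\<close>, which makes it conjugate symmetric; coordinate vectors then read off
  the entries.\<close>

lemma psd_imp_hermitian:
  assumes "psd X"
  shows "cadj X = X"
proof -
  let ?f = "\<lambda>v w. cdot v (X *v w)"
  have real: "Im (?f v v) = 0" for v
    using assms by (simp add: psd_def complex_nonneg_Reals_iff)
  have swap: "Im (?f v w) = - Im (?f w v) \<and> Re (?f v w) = Re (?f w v)" for v w
    using real [of "v + w"] real [of "v + \<i> *s w"] real [of v] real [of w]
    by (simp add: matrix_vector_right_distrib cdot_add_left cdot_add_right vector_scalar_commute
        cdot_scale_left cdot_scale_right)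
  have "?f v w = cnj (?f w v)" for v w
    using swap [of v w] by (simp add: complex_eq_iff)
  from this [of "axis _ 1" "axis _ 1"] have "cadj X $ i $ j = X $ i $ j" for i j
    unfolding cdot_axis matrix_vector_axis cadj_nth by (rule sym)
  then show ?thesis
    unfolding vec_eq_iff by blast
qed

text \<open>Degenerate Cauchy-Schwarz: along \<open>v - t P v\<close> the form is a quadratic
  polynomial in \<open>t\<close> without constant term, whose linear coefficient is
  \<open>-2\<close> times the squared norm of \<open>P *v v\<close>. It stays nonnegative only if
  that coefficient vanishes.\<close>

lemma psd_kernel:
  assumes "psd P" and "cdot v (P *v v) = 0"
  shows "P *v v = 0"
proof -
  define w where "w = P *v v"
  define a where "a = (norm w)\<^sup>2"
  define c where "c = Re (cdot w (P *v w))"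
  have herm: "cadj P = P"
    using assms(1) by (rule psd_imp_hermitian)
  have c: "c \<ge> 0"
    using assms(1) by (simp add: psd_def complex_nonneg_Reals_iff c_def)
  have q: "0 \<le> - 2 * t * a + t\<^sup>2 * c" for t :: real
  proof -
    define x where "x = complex_of_real (- t)"
    have "0 \<le> Re (cdot (v + x *s w) (P *v (v + x *s w)))"
      using assms(1) by (simp add: psd_def complex_nonneg_Reals_iff)
    moreover have "cdot v (P *v w) = of_real a"
      by (simp add: cdot_adjoint [of v] herm cdot_self flip: w_def) (simp add: a_def)
    moreover have "cdot w (P *v v) = of_real a"
      by (simp add: cdot_self a_def flip: w_def)
    moreover have "cdot (v + x *s w) (P *v (v + x *s w)) =
        cdot v (P *v v) + x * cdot v (P *v w) + cnj x * cdot w (P *v v) + cnj x * x * cdot w (P *v w)"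
      by (simp add: matrix_vector_right_distrib cdot_add_left cdot_add_right vector_scalar_commute
          cdot_scale_left cdot_scale_right distrib_left)
    ultimately show ?thesis
      using assms(2) by (simp add: c_def x_def power2_eq_square mult_ac)
  qed
  have "a = 0"
  proof (cases "c = 0")
    case True
    then show ?thesis
      using q [of 1] by (simp add: a_def)
  next
    case False
    have "- 2 * (a / c) * a + (a / c)\<^sup>2 * c = - (a\<^sup>2 / c)"
      using False by (simp add: power2_eq_square)
    with q [of "a / c"] have "a\<^sup>2 / c \<le> 0"
      by linarith
    then show ?thesis
      using c False by (simp add: divide_le_0_iff)
  qed
  then show ?thesis
    by (simp add: a_def w_def)
qed

lemma trace_eq_cdot: "trace X = (\<Sum>i\<in>UNIV. cdot (axis i 1) (X *v axis i 1))"
  by (simp add: trace_def cdot_axis matrix_vector_axis)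

lemma psd_trace_nonneg: "psd X \<Longrightarrow> trace X \<in> \<real>\<^sub>\<ge>\<^sub>0"
  unfolding trace_eq_cdot psd_def complex_nonneg_Reals_iff by (simp add: sum_nonneg)

text \<open>The diagonal entries are nonnegative with nonpositive sum, so each is zero, and by
  \<open>psd_kernel\<close> every coordinate vector is mapped to zero.\<close>

lemma psd_trace_le_0:
  assumes "psd X" and "Re (trace X) \<le> 0"
  shows "X = 0"
proof -
  have nn: "0 \<le> Re (cdot v (X *v v))" "Im (cdot v (X *v v)) = 0" for v
    using assms(1) by (auto simp: psd_def complex_nonneg_Reals_iff)
  have "(\<Sum>i\<in>UNIV. Re (cdot (axis i 1) (X *v axis i 1))) = 0"
    using assms(2) nn by (simp add: trace_eq_cdot order_antisym sum_nonneg)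
  then have "cdot (axis i 1) (X *v axis i 1) = 0" for i
    using nn by (simp add: sum_nonneg_eq_0_iff complex_eq_iff)
  then have "X *v axis i 1 = 0" for i
    using assms(1) psd_kernel by blast
  then show ?thesis
    by (simp add: vec_eq_iff matrix_vector_axis)
qed

lemma cdot_conjugate: "cdot v ((cadj D ** P ** D) *v v) = cdot (D *v v) (P *v (D *v v))"
proof -
  have "cadj (cadj D) = D"
    by (simp add: vec_eq_iff)
  then show ?thesis
    by (simp add: matrix_mul_vector_assoc cdot_adjoint [of v "cadj D"])
qed

lemma psd_conjugate: "psd P \<Longrightarrow> psd (cadj D ** P ** D)"
  by (simp add: psd_def cdot_conjugate)

text \<open>With \<open>D = P - S\<close> one has \<open>P D = - D S\<close>, so \<open>D P D\<close> and \<open>D S D\<close> are positive semidefinite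
  with opposite traces.\<close>

lemma psd_sqrt_unique:
  assumes P: "psd P" and S: "psd S" and eq: "P ** P = S ** S"
  shows "P = S"
proof -
  define D where "D = P - S"
  have herm: "cadj D = D"
    using psd_imp_hermitian [OF P] psd_imp_hermitian [OF S]
    by (simp add: D_def vec_eq_iff)
  have PD: "P ** D + D ** S = 0"
    using eq by (simp add: D_def matrix_diff_ldistrib matrix_diff_rdistrib)
  have psds: "psd (D ** P ** D)" "psd (D ** S ** D)"
    using psd_conjugate [OF P, of D] psd_conjugate [OF S, of D] by (simp_all add: herm)
  have "trace (D ** S ** D) = trace (D ** (D ** S))"
    by (rule trace_mul_sym)
  then have "trace (D ** P ** D) + trace (D ** S ** D) = trace (D ** (P ** D + D ** S))"
    by (simp add: matrix_add_ldistrib trace_add matrix_mul_assoc)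
  also have "\<dots> = 0"
    by (simp add: PD trace_def)
  finally have tr: "Re (trace (D ** P ** D)) + Re (trace (D ** S ** D)) = 0"
    by (metis plus_complex.sel(1) zero_complex.sel(1))
  moreover have "Re (trace (D ** P ** D)) \<ge> 0" "Re (trace (D ** S ** D)) \<ge> 0"
    using psds [THEN psd_trace_nonneg] by (simp_all add: complex_nonneg_Reals_iff)
  ultimately have zero: "D ** P ** D = 0" "D ** S ** D = 0"
    using psds by (auto intro!: psd_trace_le_0)
  \<comment> \<open>The forms of \<open>P\<close> and \<open>S\<close> thus vanish on the range of
    \<open>D\<close>. This gives \<open>P D = S D = 0\<close>, so \<open>D D = 0\<close>, and the
    Hermitian \<open>D\<close> is zero.\<close>
  have quad: "cdot (D *v v) (X *v (D *v v)) = cdot v ((D ** X ** D) *v v)" for v X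
    using cdot_conjugate [of v D X] by (simp add: herm)
  have "P *v (D *v v) = 0" "S *v (D *v v) = 0" for v
    by (rule psd_kernel [OF P]; simp add: quad zero; simp add: cdot_def)
      (rule psd_kernel [OF S]; simp add: quad zero; simp add: cdot_def)
  then have "D *v (D *v v) = 0" for v
    by (simp add: D_def matrix_vector_mult_diff_rdistrib)
  then have "cdot (D *v v) (D *v v) = 0" for v
    using cdot_adjoint [of v D "D *v v"] by (simp add: herm) (simp add: cdot_def)
  then have "D *v v = 0" for v
    by (simp add: cdot_self)
  then have "D = 0"
    by (simp add: matrix_eq)
  then show ?thesis
    by (simp add: D_def)
qed

section \<open>Unitary matrices and the polar decomposition\<close>

definition unitary :: "'n::finite cmat \<Rightarrow> bool"
  where "unitary U \<longleftrightarrow> cadj U ** U = mat 1"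

lemma unitary_mult:
  assumes "unitary U" and "unitary V"
  shows "unitary (U ** V)"
proof -
  have "cadj (U ** V) ** (U ** V) = cadj V ** (cadj U ** U) ** V"
    by (simp add: cadj_mult matrix_mul_assoc)
  then show ?thesis
    using assms by (simp add: unitary_def)
qed

text \<open>Supplies the maximizer for the polar decomposition. Orthonormal columns bound all
  entries by 1, and the defining equations are closed conditions.\<close>

lemma compact_unitary: "compact {U :: 'n::finite cmat. unitary U}"
proof -
  have eq: "unitary U \<longleftrightarrow>
      (\<forall>i j. (\<Sum>k\<in>UNIV. cnj (U $ k $ i) * U $ k $ j) = (if i = j then 1 else 0))"
    for U :: "'n cmat"
    by (simp add: unitary_def vec_eq_iff matrix_matrix_mult_def mat_def)
  have "norm U \<le> (\<Sum>i\<in>(UNIV :: 'n set). \<Sum>j\<in>(UNIV :: 'n set). 1)" if "unitary U" for U :: "'n cmat"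
  proof -
    have "norm (U $ k $ i) \<le> 1" for i k
    proof -
      have "(\<Sum>k\<in>UNIV. complex_of_real ((norm (U $ k $ i))\<^sup>2)) = 1"
        using that unfolding eq complex_norm_square by (simp add: mult.commute)
      then have "(\<Sum>k\<in>UNIV. (norm (U $ k $ i))\<^sup>2) = 1"
        by (metis of_real_eq_1_iff of_real_sum)
      moreover have "(norm (U $ k $ i))\<^sup>2 \<le> (\<Sum>k\<in>UNIV. (norm (U $ k $ i))\<^sup>2)"
        by (rule member_le_sum) auto
      ultimately show ?thesis
        by (simp add: power_le_one_iff abs_square_le_1)
    qed
    then have "norm (U $ i) \<le> (\<Sum>j\<in>(UNIV :: 'n set). 1)" for i
      unfolding norm_vec_def by (intro order_trans [OF L2_set_le_sum] sum_mono) auto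
    then show ?thesis
      unfolding norm_vec_def [of U] by (intro order_trans [OF L2_set_le_sum] sum_mono) auto
  qed
  then have "bounded {U :: 'n cmat. unitary U}"
    unfolding bounded_iff by blast
  moreover have "closed {U :: 'n cmat. unitary U}"
    unfolding eq by (intro closed_Collect_all closed_Collect_eq continuous_intros)
  ultimately show ?thesis
    by (simp add: compact_eq_bounded_closed)
qed

text \<open>Multiplies \<open>v\<close> by \<open>\<omega>\<close> and fixes the orthogonal complement of \<open>v\<close>, if \<open>v\<close> is a unit vector.\<close>

definition phase_shift :: "complex \<Rightarrow> complex^'n::finite \<Rightarrow> 'n cmat"
  where "phase_shift \<omega> v = mat 1 + (\<chi> i j. (\<omega> - 1) * v $ i * cnj (v $ j))"

lemma phase_shift_vector: "phase_shift \<omega> v *v w = w + ((\<omega> - 1) * cdot v w) *s v"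
  by (simp add: phase_shift_def matrix_vector_mult_add_rdistrib)
    (simp add: vec_eq_iff matrix_vector_mult_def cdot_def sum_distrib_left sum_distrib_right mult_ac)

lemma cadj_phase_shift: "cadj (phase_shift \<omega> v) = phase_shift (cnj \<omega>) v"
  by (auto simp: phase_shift_def vec_eq_iff mat_def)

text \<open>The adjoint shifts by the conjugate phase, and shifts along one unit vector compose by
  multiplying the phases.\<close>

lemma unitary_phase_shift:
  assumes "cdot v v = 1" and "cnj \<omega> * \<omega> = 1"
  shows "unitary (phase_shift \<omega> v)"
proof -
  have "phase_shift (cnj \<omega>) v *v (phase_shift \<omega> v *v w) = w" for w
  proof -
    have "phase_shift (cnj \<omega>) v *v (phase_shift \<omega> v *v w)
        = w + ((cnj \<omega> * \<omega> - 1) * cdot v w) *s v"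
      using assms(1)
      by (simp add: phase_shift_vector cdot_add_right cdot_scale_right vec_eq_iff algebra_simps)
    then show ?thesis
      by (simp add: assms(2))
  qed
  then show ?thesis
    by (simp add: unitary_def cadj_phase_shift matrix_eq matrix_mul_vector_assoc)
qed

text \<open>A rank-one change of the identity turns maximality of a trace into a condition on the
  quadratic form at the single vector \<open>v\<close>.\<close>

lemma trace_phase_shift: "trace (phase_shift \<omega> v ** M) = trace M + (\<omega> - 1) * cdot v (M *v v)"
proof -
  have "trace ((\<chi> i j. (\<omega> - 1) * v $ i * cnj (v $ j)) ** M)
      = (\<Sum>i\<in>UNIV. \<Sum>j\<in>UNIV. (\<omega> - 1) * v $ i * cnj (v $ j) * M $ j $ i)"
    by (simp add: trace_def matrix_matrix_mult_def)
  also have "\<dots> = (\<Sum>j\<in>UNIV. \<Sum>i\<in>UNIV. (\<omega> - 1) * v $ i * cnj (v $ j) * M $ j $ i)"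
    by (rule sum.swap)
  also have "\<dots> = (\<omega> - 1) * cdot v (M *v v)"
    by (simp add: cdot_def matrix_vector_mult_def sum_distrib_left mult_ac)
  finally show ?thesis
    by (simp add: phase_shift_def matrix_add_rdistrib trace_add)
qed

text \<open>Polar decomposition: \<open>U X\<close> is positive semidefinite for the unitary \<open>U\<close> that maximizes
  \<open>Re (tr (U X))\<close>.\<close>

lemma psd_sqrt_exists:
  fixes X :: "'n::finite cmat"
  shows "\<exists>P. psd P \<and> P ** P = cadj X ** X"
proof -
  have "unitary (mat 1 :: 'n cmat)"
    by (simp add: unitary_def) (simp add: vec_eq_iff mat_def)
  moreover have "continuous_on {U :: 'n cmat. unitary U} (\<lambda>U. Re (trace (U ** X)))"
    unfolding trace_def matrix_matrix_mult_def by (simp, intro continuous_intros)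
  ultimately obtain U where U: "unitary U"
    and max: "\<And>V. unitary V \<Longrightarrow> Re (trace (V ** X)) \<le> Re (trace (U ** X))"
    using continuous_attains_sup [OF compact_unitary, of "\<lambda>U. Re (trace (U ** X))"] by blast
  define M where "M = U ** X"
  have unit: "cdot v (M *v v) \<in> \<real>\<^sub>\<ge>\<^sub>0" if v: "cdot v v = 1" for v
  proof -
    define z where "z = cdot v (M *v v)"
    \<comment> \<open>This phase rotates \<open>z\<close> onto the nonnegative real axis, with 1 as
      the choice for \<open>z = 0\<close>; maximality then says
      \<open>norm z \<le> Re z\<close>.\<close>
    define \<omega> where "\<omega> = (if z = 0 then 1 else cnj z / norm z)"
    have "cnj \<omega> * \<omega> = 1"
      by (simp add: \<omega>_def complex_norm_square [symmetric] power2_eq_square)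
    with v U have "unitary (phase_shift \<omega> v ** U)"
      by (intro unitary_mult unitary_phase_shift)
    from max [OF this] have "Re ((\<omega> - 1) * z) \<le> 0"
      by (simp add: trace_phase_shift z_def M_def flip: matrix_mul_assoc)
    moreover have "\<omega> * z = norm z"
      by (simp add: \<omega>_def mult.commute [of "cnj z"] complex_norm_square [symmetric] power2_eq_square)
    ultimately have "norm z \<le> Re z"
      by (simp add: algebra_simps)
    then have "Re z = norm z"
      by (simp add: complex_Re_le_cmod order_antisym)
    then have "Im z = 0"
      using cmod_power2 [of z] by simp
    with \<open>Re z = norm z\<close> show ?thesis
      unfolding z_def [symmetric] by (simp add: complex_nonneg_Reals_iff)
  qed
  have "psd M"
    unfolding psd_def
  proof
    fix v :: "complex^'n"
    show "cdot v (M *v v) \<in> \<real>\<^sub>\<ge>\<^sub>0"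
    proof (cases "v = 0")
      case True
      then show ?thesis by (simp add: cdot_def)
    next
      case False
      define u where "u = complex_of_real (inverse (norm v)) *s v"
      have scale: "cdot (of_real r *s w) (X *v (of_real r *s w)) = of_real (r\<^sup>2) * cdot w (X *v w)"
        for r X and w :: "complex^'n"
        by (simp add: vector_scalar_commute cdot_scale_left cdot_scale_right power2_eq_square)
      have "cdot u u = 1"
        using scale [of "inverse (norm v)" v "mat 1"] False
        by (simp add: u_def cdot_self [of v] power2_eq_square field_simps)
      moreover have "v = complex_of_real (norm v) *s u"
        using False by (simp add: u_def)
      then have "cdot v (M *v v) = of_real ((norm v)\<^sup>2) * cdot u (M *v u)"
        using scale [of "norm v" u M] by simp
      ultimately show ?thesis
        using unit by (metis nonneg_Reals_mult_I nonneg_Reals_of_real_iff zero_le_power2)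
    qed
  qed
  moreover have "cadj M ** M = cadj X ** (cadj U ** U) ** X"
    by (simp add: M_def cadj_mult matrix_mul_assoc)
  then have "cadj M ** M = cadj X ** X"
    using U by (simp add: unitary_def)
  ultimately show ?thesis
    using psd_imp_hermitian by metis
qed

section \<open>The norm on columns\<close>

lemma mat_abs: "psd (mat_abs X) \<and> mat_abs X ** mat_abs X = cadj X ** X"
proof -
  have "\<exists>!P. psd P \<and> P ** P = cadj X ** X"
    using psd_sqrt_exists [of X] psd_sqrt_unique by metis
  then show ?thesis
    unfolding mat_abs_def by (rule theI')
qed

lemma mat_abs_eqI: "psd P \<Longrightarrow> P ** P = cadj X ** X \<Longrightarrow> mat_abs X = P"
  using mat_abs [of X] by (simp add: psd_sqrt_unique)

lemma trace_norm_nonneg: "trace_norm X \<ge> 0"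
  using psd_trace_nonneg [of "mat_abs X"] mat_abs [of X]
  by (simp add: trace_norm_def complex_nonneg_Reals_iff)

text \<open>A vanishing absolute value gives \<open>cadj X ** X = 0\<close>, and the squared norm of
  \<open>X *v v\<close> is \<open>cdot (cadj X *v (X *v v)) v\<close>.\<close>

lemma trace_norm_le_0:
  assumes "trace_norm X \<le> 0"
  shows "X = 0"
proof -
  have "mat_abs X = 0"
    using assms mat_abs [of X] by (intro psd_trace_le_0) (simp_all add: trace_norm_def)
  then have "cadj X ** X = 0"
    using mat_abs [of X] by simp
  then have "cadj X *v (X *v v) = 0" for v
    by (simp flip: matrix_mul_vector_assoc)
  then have "cdot (X *v v) (X *v v) = 0" for v
  proof -
    have "cdot (X *v v) (X *v v) = cdot (cadj X *v (X *v v)) v"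
      by (rule cdot_adjoint)
    then show ?thesis
      using \<open>\<And>v. cadj X *v (X *v v) = 0\<close> by (simp add: cdot_def)
  qed
  then show ?thesis
    by (simp add: cdot_self matrix_eq)
qed

lemma trace_norm_zero: "trace_norm (0 :: 'n::finite cmat) = 0"
proof -
  have "mat_abs (0 :: 'n cmat) = 0"
    by (rule mat_abs_eqI) (simp_all add: psd_def cdot_def)
  then show ?thesis
    by (simp add: trace_norm_def trace_def)
qed

text \<open>For these factors the scaled root is again positive semidefinite, so uniqueness
  identifies it. They are the ones used to normalize a column.\<close>

lemma trace_norm_scale:
  assumes "r \<ge> 0"
  shows "trace_norm (mscale (of_real r) X) = r * trace_norm X"
proof -
  have "mat_abs (mscale (of_real r) X) = mscale (of_real r) (mat_abs X)"
  proof (rule mat_abs_eqI)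
    show "psd (mscale (complex_of_real r) (mat_abs X))"
      using mat_abs [of X] assms
      by (simp add: psd_def mscale_vector_mult cdot_scale_right nonneg_Reals_mult_I)
    have "mscale (of_real r) Y ** mscale (of_real r) Z = mscale (of_real (r\<^sup>2)) (Y ** Z)"
      for Y Z :: "'a cmat"
      by (simp add: vec_eq_iff matrix_matrix_mult_def sum_distrib_left power2_eq_square mult_ac)
    moreover have "cadj (mscale (of_real r) X) = mscale (of_real r) (cadj X)"
      by (simp add: vec_eq_iff)
    ultimately show "mscale (of_real r) (mat_abs X) ** mscale (of_real r) (mat_abs X)
        = cadj (mscale (of_real r) X) ** mscale (of_real r) X"
      using mat_abs [of X] by simp
  qed
  then show ?thesis
    by (simp add: trace_norm_def trace_def sum_distrib_left)
qed

lemma col_norm_scale: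
  assumes "r \<ge> 0"
  shows "col_norm (col_scale (of_real r) \<rho>) = ennreal r * col_norm \<rho>"
proof -
  have "col_norm (col_scale (of_real r) \<rho>) =
      infsum ((*) (ennreal r) \<circ> (\<lambda>v. ennreal (trace_norm (\<rho> v)))) UNIV"
    using assms
    by (simp add: col_norm_def col_scale_def trace_norm_scale ennreal_mult trace_norm_nonneg o_def)
  also have "\<dots> = ennreal r * col_norm \<rho>"
    unfolding col_norm_def
    by (rule infsum_comm_additive_general)
      (auto simp: sum_distrib_left isCont_def intro!: ennreal_tendsto_cmult nonneg_summable_on_complete)
  finally show ?thesis .
qed

lemma col_norm_eq_0:
  assumes "col_norm \<rho> = 0"
  shows "\<rho> v = 0"
proof -
  have "infsum (\<lambda>v. ennreal (trace_norm (\<rho> v))) {v} \<le> col_norm \<rho>"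
    unfolding col_norm_def by (rule infsum_mono_neutral) (auto intro: nonneg_summable_on_complete)
  then show ?thesis
    using assms by (intro trace_norm_le_0) (simp add: ennreal_eq_0_iff)
qed

text \<open>Meant for truncations: of a solution beyond a vertex, and of an image
  \<open>T \<sigma>\<close> to the places where \<open>\<sigma>\<close> is nonzero.\<close>

lemma col_norm_mono:
  assumes "\<And>v. \<sigma> v = 0 \<or> \<sigma> v = \<rho> v"
  shows "col_norm \<sigma> \<le> col_norm \<rho>"
proof -
  have "ennreal (trace_norm (\<sigma> v)) \<le> ennreal (trace_norm (\<rho> v))" for v
    using assms [of v] by (auto simp: trace_norm_zero)
  then show ?thesis
    unfolding col_norm_def by (intro infsum_mono nonneg_summable_on_complete) auto
qed

lemma finite_support_col_space:
  assumes "finite V" and "\<And>v. v \<notin> V \<Longrightarrow> \<rho> v = 0"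
  shows "\<rho> \<in> col_space"
proof -
  have "col_norm \<rho> = infsum (\<lambda>v. ennreal (trace_norm (\<rho> v))) V"
    unfolding col_norm_def using assms(2) by (intro infsum_cong_neutral) (auto simp: trace_norm_zero)
  also have "\<dots> < \<infinity>"
    using assms(1) by simp
  finally show ?thesis
    by (simp add: col_space_def)
qed

text \<open>The last condition on \<open>\<sigma>\<close> makes it a fixed point of a compression of
  \<open>T\<close>. A nonzero such \<open>\<sigma>\<close>, scaled to norm 1, would have an image of
  norm at least 1.\<close>

lemma contraction_fixpoint_zero:
  assumes scale: "\<And>r \<sigma>. r \<ge> 0 \<Longrightarrow> T (col_scale (of_real r) \<sigma>) = col_scale (of_real r) (T \<sigma>)"
    and contr: "op_norm T < 1"
    and \<sigma>: "\<sigma> \<in> col_space" "\<And>v. \<sigma> v = 0 \<or> \<sigma> v = T \<sigma> v"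
  shows "\<sigma> v = 0"
proof (rule ccontr)
  assume "\<sigma> v \<noteq> 0"
  then have "col_norm \<sigma> \<noteq> 0"
    using col_norm_eq_0 [of \<sigma> v] by blast
  moreover have "col_norm \<sigma> < \<infinity>"
    using \<sigma>(1) by (simp add: col_space_def)
  moreover define c where "c = enn2real (col_norm \<sigma>)"
  ultimately have c: "c > 0" "col_norm \<sigma> = ennreal c"
    by (auto simp: enn2real_positive_iff intro: gr_zeroI)
  define \<tau> where "\<tau> = col_scale (of_real (inverse c)) \<sigma>"
  have one: "ennreal (inverse c) * ennreal c = 1"
    using c(1) by (simp flip: ennreal_mult)
  have "col_norm \<tau> = 1"
    using c one by (simp add: \<tau>_def col_norm_scale del: of_real_inverse)
  then have "col_norm (T \<tau>) \<le> op_norm T"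
    unfolding op_norm_def by (intro SUP_upper) simp
  moreover have "col_norm (T \<tau>) = ennreal (inverse c) * col_norm (T \<sigma>)"
    using c(1) by (simp add: \<tau>_def scale col_norm_scale del: of_real_inverse)
  moreover have "ennreal (inverse c) * col_norm \<sigma> \<le> ennreal (inverse c) * col_norm (T \<sigma>)"
    using \<sigma>(2) by (intro mult_left_mono col_norm_mono) auto
  ultimately show False
    using contr one c(2) by simp
qed

section \<open>Matrix representation of a block tridiagonal chain\<close>

definition unvec :: "complex^('n \<times> 'n) \<Rightarrow> 'n::finite cmat"
  where "unvec w = (\<chi> i j. w $ (i, j))"

lemma vec_rows_unvec [simp]: "vec_rows (unvec w) = w"
  by (simp add: vec_rows_def unvec_def vec_eq_iff)

lemma unvec_vec_rows [simp]: "unvec (vec_rows X) = X"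
  by (simp add: vec_rows_def unvec_def vec_eq_iff)

lemma vec_rows_inject: "vec_rows X = vec_rows Y \<longleftrightarrow> X = Y"
  by (metis unvec_vec_rows)

lemma vec_rows_simps [simp]:
  "vec_rows 0 = 0" "vec_rows (X + Y) = vec_rows X + vec_rows Y"
  "vec_rows (mscale c X) = c *s vec_rows X"
  by (simp_all add: vec_rows_def vec_eq_iff)

lemma unvec_simps:
  "unvec 0 = 0" "unvec (v + w) = unvec v + unvec w" "unvec (c *s v) = mscale c (unvec v)"
  by (simp_all add: unvec_def vec_eq_iff)

lemma mat_rep_eqI:
  assumes "\<And>X. vec_rows (L X) = M *v vec_rows X"
  shows "mat_rep L = M"
  unfolding mat_rep_def
proof (rule the_equality)
  fix M'
  assume "\<forall>X. vec_rows (L X) = M' *v vec_rows X"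
  then have "M' *v w = M *v w" for w
    using assms [of "unvec w"] by (metis vec_rows_unvec)
  then show "M' = M"
    by (simp add: matrix_eq)
qed (use assms in blast)

lemma mat_rep:
  assumes "Vector_Spaces.linear mscale mscale L"
  shows "vec_rows (L X) = mat_rep L *v vec_rows X"
proof -
  define g where "g w = vec_rows (L (unvec w))" for w
  have "Vector_Spaces.linear (*s) (*s) g"
    using assms unfolding Vector_Spaces.linear_iff g_def
    by (auto simp: unvec_simps vec.vector_space_axioms)
  then have "vec_rows (L X) = matrix g *v vec_rows X" for X
    using matrix_works [of g "vec_rows X"] by (simp add: g_def)
  then show ?thesis
    using mat_rep_eqI [of L "matrix g"] by simp
qed

text \<open>Only neighbours contribute. For \<open>i = 0\<close> the truncated \<open>i - 1\<close>
  is 0, so the range begins on the diagonal.\<close>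

lemma qmc_op_tridiagonal:
  assumes "block_tridiagonal \<Phi>"
  shows "qmc_op \<Phi> \<rho> i = (\<Sum>j\<in>{i - 1..Suc i}. \<Phi> i j (\<rho> j))"
proof -
  have "\<Phi> i j (\<rho> j) = 0" if "j \<notin> {i - 1..Suc i}" for j
  proof -
    from that have "i > Suc j \<or> j > Suc i"
      by auto
    then show ?thesis
      using assms by (auto simp: block_tridiagonal_def)
  qed
  then have "qmc_op \<Phi> \<rho> i = infsum (\<lambda>j. \<Phi> i j (\<rho> j)) {i - 1..Suc i}"
    unfolding qmc_op_def by (intro infsum_cong_neutral) auto
  then show ?thesis
    by simp
qed

definition tri_apply ::
  "(nat \<Rightarrow> 'm::finite cmat) \<Rightarrow> (nat \<Rightarrow> 'm cmat) \<Rightarrow> (nat \<Rightarrow> 'm cmat) \<Rightarrow>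
   (nat \<Rightarrow> complex^'m) \<Rightarrow> nat \<Rightarrow> complex^'m"
  where "tri_apply A B C w k =
    (case k of 0 \<Rightarrow> 0 | Suc m \<Rightarrow> A m *v w m) + B k *v w k + C (Suc k) *v w (Suc k)"

lemma vec_rows_qmc_op:
  assumes "block_tridiagonal \<Phi>" and lin: "\<And>i j. Vector_Spaces.linear mscale mscale (\<Phi> i j)"
  shows "vec_rows (qmc_op \<Phi> \<rho> k) =
    tri_apply (\<lambda>n. mat_rep (\<Phi> (Suc n) n)) (\<lambda>n. mat_rep (\<Phi> n n)) (\<lambda>n. mat_rep (\<Phi> (n - 1) n))
      (\<lambda>j. vec_rows (\<rho> j)) k"
proof (cases k)
  case 0
  then show ?thesis
    by (simp add: qmc_op_tridiagonal assms(1) tri_apply_def mat_rep [OF lin])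
next
  case (Suc m)
  then have "{k - 1..Suc k} = {m, Suc m, Suc (Suc m)}"
    by auto
  then show ?thesis
    using Suc by (simp add: qmc_op_tridiagonal assms(1) tri_apply_def mat_rep [OF lin] add.assoc)
qed

text \<open>\<open>C\<close> enters only at positive indices. The theorem fixes it only there, while
  \<open>mat_rep (\<Phi> (n - 1) n)\<close> at \<open>n = 0\<close> is a diagonal block.\<close>

lemma tri_apply_cong:
  assumes "w k = w' k" "w (Suc k) = w' (Suc k)" "\<And>m. k = Suc m \<Longrightarrow> w m = w' m"
    and "\<And>n. C (Suc n) = C' (Suc n)"
  shows "tri_apply A B C w k = tri_apply A B C' w' k"
  using assms by (simp add: tri_apply_def split: nat.split)

lemma tri_apply_scale: "tri_apply A B C (\<lambda>k. c *s w k) k = c *s tri_apply A B C w k"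
  by (simp add: tri_apply_def vector_scalar_commute vector_add_ldistrib split: nat.split)

text \<open>Summation by parts: the row of the \<open>Q k x\<close> is a left eigenvector up to the
  cut between \<open>j\<close> and \<open>Suc j\<close>, and the two extra terms come from the
  blocks crossing that cut.\<close>

lemma tri_apply_telescope:
  assumes "assoc_polys A B C Q"
  shows "(\<Sum>k\<le>j. Q k x *v tri_apply A B C w k) + Q (Suc j) x *v (A j *v w j) =
    x *s (\<Sum>k\<le>j. Q k x *v w k) + Q j x *v (C (Suc j) *v w (Suc j))"
proof (induction j)
  case 0
  have "x *s (Q 0 x *v w 0) = (Q 1 x ** A 0 + Q 0 x ** B 0) *v w 0"
    using assms unfolding assoc_polys_def mscale_vector_mult [symmetric] by metis
  then show ?case
    by (simp add: tri_apply_def matrix_vector_mult_add_rdistrib matrix_mul_vector_assoc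
        matrix_vector_right_distrib)
next
  case (Suc j)
  have "x *s (Q (Suc j) x *v w (Suc j)) =
      (Q (Suc (Suc j)) x ** A (Suc j) + Q (Suc j) x ** B (Suc j) + Q j x ** C (Suc j)) *v w (Suc j)"
    using assms unfolding assoc_polys_def mscale_vector_mult [symmetric] by metis
  then have "x *s (\<Sum>k\<le>Suc j. Q k x *v w k) = x *s (\<Sum>k\<le>j. Q k x *v w k) +
      Q (Suc (Suc j)) x *v (A (Suc j) *v w (Suc j)) + Q (Suc j) x *v (B (Suc j) *v w (Suc j)) +
      Q j x *v (C (Suc j) *v w (Suc j))"
    by (simp add: vector_add_ldistrib matrix_vector_mult_add_rdistrib matrix_mul_vector_assoc)
  with Suc.IH show ?case
    by (simp add: tri_apply_def matrix_vector_right_distrib algebra_simps)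
qed

lemma first_passage_identity:
  assumes Q: "assoc_polys A B C Q" and "s \<noteq> 0" and "i < j" and "w j = 0" "w (Suc j) = 0"
    and w: "\<And>k. k < j \<Longrightarrow> w k = s *s tri_apply A B C w k + (if k = i then b else 0)"
  shows "Q j (inverse s) *v (s *s tri_apply A B C w j) = Q i (inverse s) *v b"
proof -
  define x where "x = inverse s"
  obtain m where m: "j = Suc m"
    using \<open>i < j\<close> by (cases j) auto
  define S where "S = (\<Sum>k\<le>m. Q k x *v tri_apply A B C w k)"
  have "(\<Sum>k\<le>m. Q k x *v w k) =
      (\<Sum>k\<le>m. s *s (Q k x *v tri_apply A B C w k) + (if k = i then Q k x *v b else 0))"
    using w by (intro sum.cong) (auto simp: m matrix_vector_right_distrib vector_scalar_commute)
  also have "\<dots> = s *s S + Q i x *v b"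
    using \<open>i < j\<close> by (simp add: S_def sum.distrib vec.scale_sum_right m)
  \<comment> \<open>The cut lies between \<open>m\<close> and \<open>j\<close>, where
    \<open>w j = 0\<close> removes the \<open>C\<close> term. As \<open>x\<close> times
    \<open>s\<close> is 1, both sides contain \<open>S\<close>, which then cancels.\<close>
  finally have "S + Q j x *v (A m *v w m) = x *s (s *s S + Q i x *v b)"
    using tri_apply_telescope [OF Q, of x w m] \<open>w j = 0\<close> by (simp add: S_def m)
  then have "s *s (Q j x *v (A m *v w m)) = Q i x *v b"
    using \<open>s \<noteq> 0\<close> by (simp add: x_def vector_add_ldistrib)
  \<comment> \<open>Row \<open>j\<close> sees only \<open>A m *v w m\<close>, since \<open>w\<close>
    vanishes at \<open>j\<close> and \<open>Suc j\<close>.\<close>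
  then show ?thesis
    using assms(4,5) by (simp add: tri_apply_def m vector_scalar_commute x_def)
qed

section \<open>The boundary value problem for the resolvent\<close>

text \<open>Solves the rows of \<open>w = s \<Phi> w + d\<close> successively for \<open>w (k + 1)\<close>, starting from \<open>w 0 = y\<close>.\<close>

fun shoot ::
  "(nat \<Rightarrow> 'm::finite cmat) \<Rightarrow> (nat \<Rightarrow> 'm cmat) \<Rightarrow> (nat \<Rightarrow> 'm cmat) \<Rightarrow> complex \<Rightarrow>
   complex^'m \<Rightarrow> (nat \<Rightarrow> complex^'m) \<Rightarrow> nat \<Rightarrow> complex^'m"
  where
    "shoot A B C s y d 0 = y"
  | "shoot A B C s y d (Suc 0) =
      matrix_inv (C (Suc 0)) *v (inverse s *s (y - d 0) - B 0 *v y)"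
  | "shoot A B C s y d (Suc (Suc k)) =
      matrix_inv (C (Suc (Suc k))) *v
        (inverse s *s (shoot A B C s y d (Suc k) - d (Suc k))
          - A k *v shoot A B C s y d k - B (Suc k) *v shoot A B C s y d (Suc k))"

lemma matrix_inv_cancel:
  fixes M :: "'m::finite cmat"
  assumes "invertible M"
  shows "M *v (matrix_inv M *v v) = v" "matrix_inv M *v (M *v v) = v"
proof -
  have "M ** matrix_inv M = mat 1 \<and> matrix_inv M ** M = mat 1"
    using assms unfolding invertible_def matrix_inv_def by (rule someI_ex)
  then show "M *v (matrix_inv M *v v) = v" "matrix_inv M *v (M *v v) = v"
    by (simp_all flip: matrix_mul_vector_assoc)
qed

lemma shoot_solves:
  assumes "s \<noteq> 0" and "\<And>n. invertible (C (Suc n))"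
  shows "shoot A B C s y d k = s *s tri_apply A B C (shoot A B C s y d) k + d k"
proof (cases k)
  case 0
  then show ?thesis
    using assms by (simp add: tri_apply_def matrix_inv_cancel)
next
  case (Suc m)
  then show ?thesis
    using assms by (simp add: tri_apply_def matrix_inv_cancel)
qed

lemma shoot_add:
  "shoot A B C s (y + y') (\<lambda>k. d k + d' k) k = shoot A B C s y d k + shoot A B C s y' d' k"
  by (induction A B C s y d k rule: shoot.induct)
    (simp_all add: matrix_vector_right_distrib matrix_vector_mult_diff_distrib
      vector_add_ldistrib vector_ssub_ldistrib algebra_simps)

text \<open>Real scalars, because \<open>linear\<close> and the dimension argument in
  \<open>shoot_boundary_value\<close> refer to the real vector space.\<close>

lemma shoot_scale: "shoot A B C s (r *\<^sub>R y) (\<lambda>k. r *\<^sub>R d k) k = r *\<^sub>R shoot A B C s y d k"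
proof -
  have comm: "c *s (r *\<^sub>R v) = r *\<^sub>R (c *s v)" for c and v :: "complex^'a"
    by (simp add: vec_eq_iff)
  have mult: "M *v (r *\<^sub>R v) = r *\<^sub>R (M *v v)" for M :: "'a cmat" and v
    by (rule linear_scale [OF matrix_vector_mul_linear])
  show ?thesis
    by (induction A B C s y d k rule: shoot.induct)
      (simp_all add: mult scaleR_diff_right comm matrix_vector_mult_diff_distrib
        vector_ssub_ldistrib)
qed

text \<open>Fredholm alternative: the value at \<open>j\<close> is affine in \<open>y\<close>. Its
  linear part is injective, hence surjective by dimension, so some homogeneous run cancels the run
  started at 0 with \<open>d\<close>.\<close>

lemma shoot_boundary_value:
  assumes inj: "\<And>y. shoot A B C s y (\<lambda>_. 0) j = 0 \<Longrightarrow> y = 0"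
  shows "\<exists>y. shoot A B C s y d j = 0"
proof -
  have "linear (\<lambda>y. shoot A B C s y (\<lambda>_. 0) j)"
    using shoot_add [of A B C s _ _ "\<lambda>_. 0" "\<lambda>_. 0" j] shoot_scale [of A B C s _ _ "\<lambda>_. 0" j]
    by (intro linearI) simp_all
  moreover from this have "inj (\<lambda>y. shoot A B C s y (\<lambda>_. 0) j)"
    using inj by (simp add: linear_injective_0)
  ultimately have "surj (\<lambda>y. shoot A B C s y (\<lambda>_. 0) j)"
    by (intro linear_injective_imp_surjective refl)
  then obtain y where "- shoot A B C s 0 d j = shoot A B C s y (\<lambda>_. 0) j"
    unfolding surj_def by blast
  then have "shoot A B C s y d j = 0"
    using shoot_add [of A B C s y 0 "\<lambda>_. 0" d j] by (simp flip: \<open>- shoot A B C s 0 d j = _\<close>)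
  then show ?thesis ..
qed

section \<open>The first passage time operator\<close>

theorem mainTheorem3:
  fixes \<Phi> :: "nat \<Rightarrow> nat \<Rightarrow> 'n::finite cmat \<Rightarrow> 'n cmat"
    and A B C R :: "nat \<Rightarrow> ('n \<times> 'n) cmat"
    and Q :: "nat \<Rightarrow> complex \<Rightarrow> ('n \<times> 'n) cmat"
    and s :: complex
  assumes "qmc \<Phi>"
    and "block_tridiagonal \<Phi>"
    and "\<And>n. A n = mat_rep (\<Phi> (Suc n) n)"
    and "\<And>n. B n = mat_rep (\<Phi> n n)"
    and "\<And>n. C (Suc n) = mat_rep (\<Phi> n (Suc n))"
    and "\<And>n. invertible (A n)"
    and "\<And>n. invertible (C (Suc n))"
    and "\<And>n. invertible (R n)"
    and "\<And>n. hermitian (R n ** B n ** matrix_inv (R n))"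
    and "\<And>n. n \<ge> 1 \<Longrightarrow>
      cadj (R n) ** R n =
        matrix_inv (mat_prod (\<lambda>k. cadj (A k)) n) ** (cadj (R 0) ** R 0) **
        mat_prod (\<lambda>k. C (Suc k)) n"
    and "assoc_polys A B C Q"
    and "s \<noteq> 0"
    and "op_norm (\<lambda>\<rho>. col_scale s (qmc_op \<Phi> \<rho>)) < 1"
  shows "\<forall>i j. i < j \<longrightarrow>
    invertible (Q j (inverse s)) \<and>
    first_passage \<Phi> s j i = matrix_inv (Q j (inverse s)) ** Q i (inverse s)"
proof -
  note tri = assms(2) and C_inv = assms(7) and Q = assms(11) and s = assms(12)
  have lin: "Vector_Spaces.linear mscale mscale (\<Phi> i j)" for i j
    using assms(1) by (simp add: qmc_def completely_positive_def)
  define T where "T = (\<lambda>\<rho>. col_scale s (qmc_op \<Phi> \<rho>))"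
  have row: "vec_rows (qmc_op \<Phi> \<rho> k) = tri_apply A B C (\<lambda>v. vec_rows (\<rho> v)) k" for \<rho> k
  proof -
    have AB: "(\<lambda>n. mat_rep (\<Phi> (Suc n) n)) = A" "(\<lambda>n. mat_rep (\<Phi> n n)) = B"
      using assms(3,4) by auto
    show ?thesis
      unfolding vec_rows_qmc_op [OF tri lin] AB by (rule tri_apply_cong) (simp_all add: assms(5))
  qed
  have solves: "shoot A B C s y d k = s *s tri_apply A B C (shoot A B C s y d) k + d k" for y d k
    using s C_inv by (rule shoot_solves)
  have T_row: "vec_rows (T \<rho> k) = s *s tri_apply A B C (\<lambda>v. vec_rows (\<rho> v)) k" for \<rho> k
    by (simp add: T_def col_scale_def row)
  have T_scale: "T (col_scale c \<rho>) = col_scale c (T \<rho>)" for c \<rho>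
  proof
    fix k
    have "vec_rows (T (col_scale c \<rho>) k) = vec_rows (col_scale c (T \<rho>) k)"
      by (simp add: T_row col_scale_def tri_apply_scale vec_eq_iff)
    then show "T (col_scale c \<rho>) k = col_scale c (T \<rho>) k"
      by (simp add: vec_rows_inject)
  qed
  have T_cong: "T \<rho> k = T \<rho>' k"
    if "\<rho> k = \<rho>' k" "\<rho> (Suc k) = \<rho>' (Suc k)" "\<And>m. k = Suc m \<Longrightarrow> \<rho> m = \<rho>' m" for \<rho> \<rho>' k
  proof -
    have "vec_rows (T \<rho> k) = vec_rows (T \<rho>' k)"
      unfolding T_row using that by (intro arg_cong [where f = "(*s) s"] tri_apply_cong) auto
    then show ?thesis
      by (simp add: vec_rows_inject)
  qed
  have zero: "\<sigma> v = 0" if "\<sigma> \<in> col_space" "\<And>v. \<sigma> v = 0 \<or> \<sigma> v = T \<sigma> v" for \<sigma> v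
    using assms(13) that unfolding T_def [symmetric]
    by (intro contraction_fixpoint_zero [of T]) (auto simp: T_scale)

  have key: "Q j (inverse s) *v vec_rows (op_block (\<lambda>\<rho>. col_scale s (proj_at j
        (qmc_op \<Phi> (passage_resolvent \<Phi> s j (proj_at i \<rho>))))) j i X) =
      Q i (inverse s) *v vec_rows X" if "i < j" for i j X
  proof -
    define G where "G = (\<lambda>\<rho> v. \<rho> v - col_scale s (coproj_at j (qmc_op \<Phi> \<rho>)) v)"
    \<comment> \<open>\<open>G\<close> is the operator inverted in \<open>passage_resolvent\<close>;
      the coprojection erases row \<open>j\<close> of \<Phi>, so \<open>G\<close> leaves the entry
      at \<open>j\<close> alone.\<close>
    have G: "G \<rho> v = (if v = j then \<rho> v else \<rho> v - T \<rho> v)" for \<rho> v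
      by (simp add: G_def T_def col_scale_def coproj_at_def proj_at_def vec_eq_iff)
    define d where "d k = (if k = i then vec_rows X else 0)" for k
    \<comment> \<open>This yields a preimage of \<open>col_single i X\<close> under
      \<open>G\<close>, so that \<open>inv_into\<close> returns a genuine solution.\<close>
    have "\<exists>y. shoot A B C s y d j = 0"
    proof (rule shoot_boundary_value)
      fix y assume y: "shoot A B C s y (\<lambda>_. 0) j = 0"
      \<comment> \<open>Cut off at \<open>j\<close>, a homogeneous solution becomes a column of
        finite support that \<open>T\<close> fixes below \<open>j\<close>. The contraction forces it
        to vanish, and its entry at 0 encodes \<open>y\<close>.\<close>
      define w where "w = shoot A B C s y (\<lambda>_. 0)"
      define \<sigma> where "\<sigma> k = (if k < j then unvec (w k) else 0)" for k
      \<comment> \<open>The case \<open>u = j\<close>, where both sides vanish, matters because row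
        \<open>j - 1\<close> reads that entry.\<close>
      have \<sigma>_row: "vec_rows (\<sigma> u) = w u" if "u \<le> j" for u
        using that y by (cases "u = j") (auto simp: \<sigma>_def w_def)
      have "\<sigma> v = T \<sigma> v" if "v < j" for v
      proof -
        have "vec_rows (T \<sigma> v) = s *s tri_apply A B C w v"
          unfolding T_row using that
          by (intro arg_cong [where f = "(*s) s"] tri_apply_cong)
            (simp_all add: \<sigma>_row)
        also have "\<dots> = vec_rows (\<sigma> v)"
          using solves [of y "\<lambda>_. 0" v] that by (simp add: \<sigma>_def w_def)
        finally show ?thesis
          by (simp add: vec_rows_inject)
      qed
      moreover have "\<sigma> v = 0" if "\<not> v < j" for v
        using that by (simp add: \<sigma>_def)
      ultimately have "\<sigma> v = 0 \<or> \<sigma> v = T \<sigma> v" for v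
        by metis
      moreover have "\<sigma> \<in> col_space"
        by (rule finite_support_col_space [of "{..<j}"]) (auto simp: \<sigma>_def)
      ultimately have "\<sigma> 0 = 0"
        by (intro zero)
      then show "y = 0"
        using \<open>i < j\<close> vec_rows_unvec [of y] by (simp add: \<sigma>_def w_def)
    qed
    then obtain y where y: "shoot A B C s y d j = 0" ..
    define w where "w = shoot A B C s y d"
    define \<rho> where "\<rho> k = (if k < j then unvec (w k) else 0)" for k
    have \<rho>_row: "vec_rows (\<rho> u) = w u" if "u \<le> j" for u
      using that y by (cases "u = j") (auto simp: \<rho>_def w_def)
    have "G \<rho> v = col_single i X v" for v
    proof (cases v j rule: linorder_cases)
      case less
      have "vec_rows (T \<rho> v) = s *s tri_apply A B C w v"
        unfolding T_row using less
        by (intro arg_cong [where f = "(*s) s"] tri_apply_cong)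
          (simp_all add: \<rho>_row)
      also have "s *s tri_apply A B C w v + d v = vec_rows (\<rho> v)"
        using solves [of y d v] less by (simp add: \<rho>_def w_def)
      finally have "vec_rows (\<rho> v) = vec_rows (T \<rho> v + col_single i X v)"
        by (auto simp: d_def col_single_def split: if_splits)
      then show ?thesis
        using less by (simp add: G vec_rows_inject del: vec_rows_simps(2))
    next
      case equal
      then show ?thesis
        using that by (simp add: G \<rho>_def col_single_def)
    next
      case greater
      \<comment> \<open>Row \<open>v\<close> reads entries from \<open>v - 1 \<ge> j\<close> on,
        where \<open>\<rho>\<close> is zero.\<close>
      then have "T \<rho> v = T (\<lambda>_. 0) v"
        by (intro T_cong) (auto simp: \<rho>_def)
      also have "\<dots> = 0"
        using T_scale [of 0 "\<lambda>_. 0"] by (simp add: col_scale_def mscale_zero fun_eq_iff)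
      finally show ?thesis
        using greater that by (simp add: G \<rho>_def col_single_def)
    qed
    then have "col_single i X = G \<rho>"
      by (simp add: fun_eq_iff)
    moreover have "\<rho> \<in> col_space"
      by (rule finite_support_col_space [of "{..<j}"]) (auto simp: \<rho>_def)
    ultimately have image: "col_single i X \<in> G ` col_space"
      by simp
    \<comment> \<open>\<open>inv_into\<close> chooses some preimage, a priori not
      \<open>\<rho>\<close>; what follows about \<open>\<psi>\<close> is drawn from its equation and
      its membership in \<open>col_space\<close>.\<close>
    define \<psi> where "\<psi> = passage_resolvent \<Phi> s j (col_single i X)"
    have \<psi>: "\<psi> \<in> col_space" "G \<psi> = col_single i X"
      using inv_into_into [OF image] f_inv_into_f [OF image]
      unfolding \<psi>_def passage_resolvent_def G_def by simp_all
    have \<psi>_eq: "(if v = j then \<psi> v else \<psi> v - T \<psi> v) = (if v = i then X else 0)" for v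
      using fun_cong [OF \<psi>(2), of v] by (simp add: G col_single_def)
    have \<psi>_j: "\<psi> j = 0"
      using \<psi>_eq [of j] that by simp
    \<comment> \<open>\<open>\<psi> j = 0\<close> decouples the vertices beyond \<open>j\<close>
      from those below, so the tail satisfies a truncated fixed point equation by itself.\<close>
    define \<sigma> where "\<sigma> k = (if k > j then \<psi> k else 0)" for k
    have "\<sigma> v = 0 \<or> \<sigma> v = T \<sigma> v" for v
    proof (cases "v > j")
      case True
      then have "T \<sigma> v = T \<psi> v"
        using \<psi>_j by (intro T_cong) (auto simp: \<sigma>_def less_Suc_eq)
      then show ?thesis
        using \<psi>_eq [of v] True that by (simp add: \<sigma>_def)
    qed (simp add: \<sigma>_def)
    moreover have "col_norm \<sigma> \<le> col_norm \<psi>"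
      by (rule col_norm_mono) (simp add: \<sigma>_def)
    then have "\<sigma> \<in> col_space"
      using \<psi>(1) by (auto simp: col_space_def)
    ultimately have "\<sigma> (Suc j) = 0"
      by (intro zero)
    then have "\<psi> (Suc j) = 0"
      by (simp add: \<sigma>_def)
    moreover have "vec_rows (\<psi> k) =
        s *s tri_apply A B C (\<lambda>v. vec_rows (\<psi> v)) k + (if k = i then vec_rows X else 0)"
      if "k < j" for k
    proof -
      have "\<psi> k = T \<psi> k + (if k = i then X else 0)"
        using \<psi>_eq [of k] that by (simp add: algebra_simps split: if_splits)
      then have "vec_rows (\<psi> k) = vec_rows (T \<psi> k + (if k = i then X else 0))"
        by (rule arg_cong)
      then show ?thesis
        by (auto simp: T_row)
    qed
    ultimately have "Q j (inverse s) *v (s *s tri_apply A B C (\<lambda>v. vec_rows (\<psi> v)) j) =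
        Q i (inverse s) *v vec_rows X"
      using \<psi>_j by (intro first_passage_identity [OF Q s that]) auto
    moreover have "proj_at i (col_single i X) = col_single i X"
      by (auto simp: proj_at_def col_single_def)
    then have "op_block (\<lambda>\<rho>. col_scale s (proj_at j
        (qmc_op \<Phi> (passage_resolvent \<Phi> s j (proj_at i \<rho>))))) j i X = T \<psi> j"
      by (simp add: op_block_def T_def col_scale_def proj_at_def \<psi>_def)
    ultimately show ?thesis
      by (simp add: T_row)
  qed
  have Q_inv: "invertible (Q j (inverse s))" if "0 < j" for j
  proof -
    \<comment> \<open>For \<open>i = 0\<close> the right side of \<open>key\<close> is an arbitrary
      vector, so \<open>Q j (inverse s)\<close> is surjective; a surjective square matrix is
      invertible.\<close>
    have "Q 0 (inverse s) = mat 1"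
      using Q unfolding assoc_polys_def by blast
    then have "\<exists>v. Q j (inverse s) *v v = w" for w
      using key [OF that, of "unvec w"] by auto
    then have "surj ((*v) (Q j (inverse s)))"
      by (metis surjI)
    then show ?thesis
      using matrix_right_invertible_surjective [of "Q j (inverse s)"]
      by (simp add: invertible_right_inverse)
  qed
  show ?thesis
  proof (intro allI impI conjI)
    fix i j :: nat
    assume "i < j"
    then show inv: "invertible (Q j (inverse s))"
      by (intro Q_inv) auto
    show "first_passage \<Phi> s j i = matrix_inv (Q j (inverse s)) ** Q i (inverse s)"
      unfolding first_passage_def
      by (rule mat_rep_eqI)
        (simp add: matrix_mul_vector_assoc key [OF \<open>i < j\<close>, symmetric] matrix_inv_cancel(2) [OF inv])
  qed
qed

end
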